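(* For all integers $m \geq 3$ and $n \geq 2$, the tensor product $H_m \times K_{1,n}$ of the helm $H_m$ and the star $K_{1,n}$ admits an antimagic labeling (i.e. is antimagic).
   Context: All graphs are finite, simple and undirected. Antimagic labeling: for a graph $G$ with $q = |E(G)|$ edges, an antimagic labeling is a bijection $f : E(G) \to \{1,2,\dots,q\}$ such that $\phi_f(u) \neq \phi_f(v)$ for all distinct $u,v \in V(G)$, where $\phi_f(u)$ is the sum of the labels $f(e)$ over all edges $e$ incident to $u$. $G$ is antimagic if it admits an antimagic labeling. Tensor product: $G \times H$ has vertex set $V(G) \times V(H)$, and $(x_1,y_1)$ is adjacent to $(x_2,y_2)$ if and only if $x_1x_2 \in E(G)$ and $y_1y_2 \in E(H)$. Star: $K_{1,n}$ is the complete bipartite graph with a central vertex adjacent to each of $n$ other vertices (and no other edges). Wheel: $W_m$ ($m\ge 3$) has vertices $u_0,u_1,\dots,u_m$; the vertices $u_1,\dots,u_m$ form a cycle $C_m$ with edges $u_iu_{i+1}$ ($1\le i\le m-1$) and $u_mu_1$, and the central vertex $u_0$ is adjacent to every $u_i$, $1\le i\le m$. Helm: $H_m$ is obtained from $W_m$ by adding $m$ new vertices $u_{m+1},\dots,u_{2m}$ and the edges $u_iu_{m+i}$ for $1\le i\le m$ (so $H_m$ has $2m+1$ vertices and $3m$ edges). *)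

theory Defs
  imports Main
begin

type_synonym 'a graph = "'a set \<times> 'a set set"

abbreviation verts :: "'a graph \<Rightarrow> 'a set" where
  "verts G \<equiv> fst G"

abbreviation edges :: "'a graph \<Rightarrow> 'a set set" where
  "edges G \<equiv> snd G"

definition simple_graph :: "'a graph \<Rightarrow> bool" where
  "simple_graph G \<longleftrightarrow> finite (verts G) \<and> (\<forall>e\<in>edges G. e \<subseteq> verts G \<and> card e = 2)"

definition vertex_sum :: "'a graph \<Rightarrow> ('a set \<Rightarrow> nat) \<Rightarrow> 'a \<Rightarrow> nat" where
  "vertex_sum G f u = (\<Sum>e\<in>{e \<in> edges G. u \<in> e}. f e)"

definition antimagic_labeling :: "'a graph \<Rightarrow> ('a set \<Rightarrow> nat) \<Rightarrow> bool" where
  "antimagic_labeling G f \<longleftrightarrow>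
     bij_betw f (edges G) {1..card (edges G)} \<and>
     (\<forall>u\<in>verts G. \<forall>v\<in>verts G. u \<noteq> v \<longrightarrow> vertex_sum G f u \<noteq> vertex_sum G f v)"

definition antimagic :: "'a graph \<Rightarrow> bool" where
  "antimagic G \<longleftrightarrow> (\<exists>f. antimagic_labeling G f)"

definition tensor_product :: "'a graph \<Rightarrow> 'b graph \<Rightarrow> ('a \<times> 'b) graph" where
  "tensor_product G H =
     (verts G \<times> verts H,
      {{(x1, y1), (x2, y2)} | x1 y1 x2 y2. {x1, x2} \<in> edges G \<and> {y1, y2} \<in> edges H})"

text \<open>The centre of the star is vertex 0.\<close>

definition star :: "nat \<Rightarrow> nat graph" where
  "star n = ({0..n}, {{0, j} | j. j \<in> {1..n}})"

text \<open>In the wheel and the helm, the number i stands for the vertex \<open>u\<^sub>i\<close>.\<close>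

definition wheel :: "nat \<Rightarrow> nat graph" where
  "wheel m =
     ({0..m},
      {{i, i + 1} | i. i \<in> {1..m - 1}} \<union> {{m, 1}} \<union> {{0, i} | i. i \<in> {1..m}})"

definition helm :: "nat \<Rightarrow> nat graph" where
  "helm m =
     (verts (wheel m) \<union> {m + 1..2 * m},
      edges (wheel m) \<union> {{i, m + i} | i. i \<in> {1..m}})"

lemma tensor_product_adjacent_iff:
  "{(x1, y1), (x2, y2)} \<in> edges (tensor_product G H) \<longleftrightarrow>
     {x1, x2} \<in> edges G \<and> {y1, y2} \<in> edges H"
  by (auto simp: tensor_product_def doubleton_eq_iff insert_commute)

lemma simple_graph_star: "simple_graph (star n)"
  by (auto simp: simple_graph_def star_def card_2_iff)

lemma simple_graph_wheel: "m \<ge> 3 \<Longrightarrow> simple_graph (wheel m)"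
  by (auto simp: simple_graph_def wheel_def)

lemma simple_graph_helm: "m \<ge> 3 \<Longrightarrow> simple_graph (helm m)"
  by (auto simp: simple_graph_def helm_def wheel_def)

lemma simple_graph_tensor_product:
  assumes "simple_graph G" "simple_graph H"
  shows "simple_graph (tensor_product G H)"
proof -
  have "x1 \<noteq> x2" "x1 \<in> verts G" "x2 \<in> verts G" if "{x1, x2} \<in> edges G" for x1 x2
    using assms(1) that by (force simp: simple_graph_def)+
  moreover have "y1 \<in> verts H" "y2 \<in> verts H" if "{y1, y2} \<in> edges H" for y1 y2
    using assms(2) that by (force simp: simple_graph_def)+
  ultimately show ?thesis
    using assms by (auto simp: simple_graph_def tensor_product_def)
qed

lemma card_verts_helm: "card (verts (helm m)) = 2 * m + 1"
proof -
  have "verts (helm m) = {0..2 * m}"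
    by (auto simp: helm_def wheel_def)
  then show ?thesis by simp
qed

lemma card_edges_helm:
  assumes "m \<ge> 3"
  shows "card (edges (helm m)) = 3 * m"
proof -
  let ?A = "(\<lambda>i. {i, i + 1}) ` {1..m - 1}" and ?B = "{{m, 1}}"
    and ?C = "(\<lambda>i. {0, i}) ` {1..m}" and ?D = "(\<lambda>i. {i, m + i}) ` {1..m}"
  have E: "edges (helm m) = ((?A \<union> ?B) \<union> ?C) \<union> ?D"
    unfolding helm_def wheel_def by auto
  have "card ?A = m - 1" "card ?C = m" "card ?D = m"
    by (auto simp: card_image inj_on_def doubleton_eq_iff)
  moreover have "?A \<inter> ?B = {}" "(?A \<union> ?B) \<inter> ?C = {}" "((?A \<union> ?B) \<union> ?C) \<inter> ?D = {}"
    using assms by (auto simp: doubleton_eq_iff)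
  ultimately show ?thesis
    unfolding E using assms by (simp add: card_Un_disjoint)
qed

end

theory Submission
  imports Defs
begin

text \<open>
  Write \<open>H\<close> for the helm and \<open>N = m n\<close>. An edge of \<open>H \<times> K\<^sub>1\<^sub>,\<^sub>n\<close> joins some \<open>(x, 0)\<close> to some \<open>(y, j)\<close> with
  \<open>j \<ge> 1\<close>, so it is an arc \<open>(x, y)\<close> of \<open>H\<close> together with an index \<open>j\<close>. The arcs come in six kinds of
  \<open>m\<close> arcs each: rim to pendant, pendant to rim, rim to hub, hub to rim, and rim to the next and to
  the previous rim vertex. Each kind receives one block \<open>{k N + 1..k N + N}\<close> of consecutive labels,
  where \<open>k < 6\<close> is its layer, and inside a block the labels follow an \<open>m\<close> by \<open>n\<close> table, so that all
  vertex sums have closed forms (the lemmas \<open>value_*\<close>).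

  There are six classes of vertices: the hub, rim and pendant vertices of \<open>H\<close>, each paired with the
  centre of the star or with one of its leaves (the latter are called copies below). Within a class
  the closed forms increase with the row, the column or the table entry. Two classes are kept apart by size: up to the
  factor \<open>N/2\<close>, the sums of a class lie in a short window (the lemmas \<open>window_*\<close>). Layer 0 goes to the
  arcs rim to pendant, which makes the pendant copies the smallest, and layer 5 to the arcs hub to
  rim, which makes the hub the largest. The remaining windows lie around

    \<^item> \<open>(2 b + 1) n\<close> for the pendants, \<open>b\<close> being the layer of the arcs pendant to rim,
    \<^item> \<open>(2 c + 1) m\<close> for the hub copies, \<open>c\<close> being the layer of the arcs rim to hub,
    \<^item> \<open>34 - 2 c\<close> for the rim copies,
    \<^item> \<open>(24 - 2 b) n\<close> for the rim.

  No single choice of layers keeps these windows disjoint for all \<open>m\<close> and \<open>n\<close>, because \<open>m\<close> and \<open>n\<close> are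
  independent. But \<open>c\<close> changes the size of the hub copies, and \<open>b\<close> that of the pendants, by enough that
  one of three choices of \<open>(b, c)\<close> always works (\<open>separated_layers\<close>).
\<close>

section \<open>Labelings of a tensor product with a star\<close>

definition arcs :: "'a graph \<Rightarrow> ('a \<times> 'a) set" where
  "arcs G = {(x, y). {x, y} \<in> edges G}"

lemma edges_tensor_star:
  "edges (tensor_product G (star n)) = (\<lambda>((x, y), j). {(x, 0), (y, j)}) ` (arcs G \<times> {1..n})"
    (is "?E = ?g ` ?I")
proof
  show "?g ` ?I \<subseteq> ?E"
  proof
    fix e assume "e \<in> ?g ` ?I"
    then obtain x y j where "{x, y} \<in> edges G" "j \<in> {1..n}" "e = {(x, 0), (y, j)}"
      by (auto simp: arcs_def)
    moreover from this have "{0, j} \<in> edges (star n)" unfolding star_def snd_conv by blast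
    ultimately show "e \<in> ?E"
      by (simp only: tensor_product_adjacent_iff simp_thms)
  qed
  show "?E \<subseteq> ?g ` ?I"
  proof
    fix e assume "e \<in> ?E"
    then obtain x1 y1 x2 y2 where e: "e = {(x1, y1), (x2, y2)}"
      and x: "{x1, x2} \<in> edges G" and y: "{y1, y2} \<in> edges (star n)"
      unfolding tensor_product_def snd_conv by blast
    from y obtain j where j: "j \<in> {1..n}" and "{y1, y2} = {0, j}"
      unfolding star_def snd_conv by blast
    then consider "y1 = 0" "y2 = j" | "y1 = j" "y2 = 0"
      unfolding doubleton_eq_iff by blast
    then show "e \<in> ?g ` ?I"
    proof cases
      case 1
      then show ?thesis using e x j by (intro image_eqI[of _ _ "((x1, x2), j)"]) (simp_all add: arcs_def)
    next
      case 2
      then show ?thesis using e x j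
        by (intro image_eqI[of _ _ "((x2, x1), j)"]) (simp_all add: arcs_def insert_commute)
    qed
  qed
qed

lemma inj_on_tensor_star_edge:
  fixes A :: "('a \<times> 'a) set" and n :: nat
  shows "inj_on (\<lambda>((x, y), j). {(x, 0), (y, j)}) (A \<times> {1..n})"
proof (rule inj_onI)
  fix s t :: "('a \<times> 'a) \<times> nat"
  assume st: "s \<in> A \<times> {1..n}" "t \<in> A \<times> {1..n}"
    and eq: "(\<lambda>((x, y), j). {(x, 0), (y, j)}) s = (\<lambda>((x, y), j). {(x, 0), (y, j)}) t"
  obtain x y j x' y' j' where [simp]: "s = ((x, y), j)" "t = ((x', y'), j')"
    by (metis surj_pair)
  from eq have "{(x, 0), (y, j)} = {(x', 0), (y', j')}"
    by simp
  with st show "s = t"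
    unfolding doubleton_eq_iff by simp
qed

text \<open>The vertex sum at \<open>(v, k)\<close> when \<open>L x y j\<close> is the label of the edge from \<open>(x, 0)\<close> to \<open>(y, j)\<close>: the
  centre of the star sees the arcs leaving \<open>v\<close> in all copies, a leaf those entering \<open>v\<close> in its own.\<close>

definition star_sum :: "'a graph \<Rightarrow> nat \<Rightarrow> ('a \<Rightarrow> 'a \<Rightarrow> nat \<Rightarrow> nat) \<Rightarrow> 'a \<times> nat \<Rightarrow> nat" where
  "star_sum G n L = (\<lambda>(v, k).
     if k = 0 then \<Sum>y\<in>{y. (v, y) \<in> arcs G}. \<Sum>j=1..n. L v y j
     else \<Sum>x\<in>{x. (x, v) \<in> arcs G}. L x v k)"

text \<open>Arcs with an index parametrise the edges bijectively, so a labeling may be given on arcs, where no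
  unordered pair has to be taken apart.\<close>

lemma antimagic_tensor_starI:
  assumes bij: "bij_betw (\<lambda>((x, y), j). L x y j) (arcs G \<times> {1..n}) {1..N}"
    and inj: "inj_on (star_sum G n L) (verts G \<times> {0..n})"
  shows "antimagic (tensor_product G (star n))"
proof -
  let ?T = "tensor_product G (star n)"
  let ?I = "arcs G \<times> {1..n}"
  let ?g = "\<lambda>((x::'a, y::'a), j::nat). {(x, 0::nat), (y, j)}"
  let ?L = "\<lambda>((x, y), j). L x y j"
  let ?f = "?L \<circ> the_inv_into ?I ?g"
  have g: "bij_betw ?g ?I (edges ?T)"
    unfolding bij_betw_def edges_tensor_star by (simp only: inj_on_tensor_star_edge simp_thms)
  have f: "bij_betw ?f (edges ?T) {1..N}"
    using bij_betw_trans[OF bij_betw_the_inv_into[OF g] bij] .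
  then have card: "card (edges ?T) = N"
    using bij_betw_same_card by fastforce
  have sum_eq: "vertex_sum ?T ?f v = (\<Sum>t\<in>{t \<in> ?I. v \<in> ?g t}. ?L t)" for v
  proof -
    have "vertex_sum ?T ?f v = (\<Sum>e\<in>?g ` {t \<in> ?I. v \<in> ?g t}. ?f e)"
      unfolding vertex_sum_def edges_tensor_star by (rule sum.cong) blast+
    also have "\<dots> = (\<Sum>t\<in>{t \<in> ?I. v \<in> ?g t}. ?f (?g t))"
      by (rule sum.reindex[unfolded comp_def])
        (rule inj_on_subset[OF inj_on_tensor_star_edge[of "arcs G" n]], auto)
    also have "\<dots> = (\<Sum>t\<in>{t \<in> ?I. v \<in> ?g t}. ?L t)"
      using the_inv_into_f_f[OF inj_on_tensor_star_edge[of "arcs G" n]]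
      by (intro sum.cong) auto
    finally show ?thesis .
  qed
  have star_sum: "vertex_sum ?T ?f (v, k) = star_sum G n L (v, k)" if "k \<le> n" for v k
  proof (cases "k = 0")
    case True
    have "{t \<in> ?I. (v, k) \<in> ?g t} = Pair v ` {y. (v, y) \<in> arcs G} \<times> {1..n}"
      using True by auto
    then have "vertex_sum ?T ?f (v, k) = (\<Sum>t\<in>Pair v ` {y. (v, y) \<in> arcs G} \<times> {1..n}. ?L t)"
      unfolding sum_eq by (rule arg_cong)
    then show ?thesis
      by (simp add: True star_sum_def sum.reindex inj_on_def flip: sum.cartesian_product)
  next
    case False
    have "{t \<in> ?I. (v, k) \<in> ?g t} = (\<lambda>x. ((x, v), k)) ` {x. (x, v) \<in> arcs G}"
      using False that by auto
    then have "vertex_sum ?T ?f (v, k) = (\<Sum>t\<in>(\<lambda>x. ((x, v), k)) ` {x. (x, v) \<in> arcs G}. ?L t)"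
      unfolding sum_eq by (rule arg_cong)
    then show ?thesis
      using False by (simp add: star_sum_def sum.reindex inj_on_def)
  qed
  have "verts ?T = verts G \<times> {0..n}"
    by (simp add: tensor_product_def star_def)
  then have "antimagic_labeling ?T ?f"
    unfolding antimagic_labeling_def using f card inj star_sum by (auto simp: inj_on_def)
  then show ?thesis
    unfolding antimagic_def by blast
qed

section \<open>The helm\<close>

definition rim_next :: "nat \<Rightarrow> nat \<Rightarrow> nat" where
  "rim_next m i = (if i = m then 1 else i + 1)"

definition rim_prev :: "nat \<Rightarrow> nat \<Rightarrow> nat" where
  "rim_prev m i = (if i = 1 then m else i - 1)"

lemma rim_in: "i \<in> {1..m} \<Longrightarrow> rim_next m i \<in> {1..m}" "i \<in> {1..m} \<Longrightarrow> rim_prev m i \<in> {1..m}"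
  by (auto simp: rim_next_def rim_prev_def)

lemma rim_prev_next: "i \<in> {1..m} \<Longrightarrow> rim_prev m (rim_next m i) = i"
  and rim_next_prev: "i \<in> {1..m} \<Longrightarrow> rim_next m (rim_prev m i) = i"
  by (auto simp: rim_next_def rim_prev_def)

lemma rim_next_neq_prev: "m \<ge> 3 \<Longrightarrow> i \<in> {1..m} \<Longrightarrow> rim_next m i \<noteq> rim_prev m i"
  by (auto simp: rim_next_def rim_prev_def)

lemma rim_prev_image: "rim_prev m ` {1..m} = {1..m}"
proof
  show "rim_prev m ` {1..m} \<subseteq> {1..m}"
    using rim_in by blast
  show "{1..m} \<subseteq> rim_prev m ` {1..m}"
    using rim_in rim_prev_next by (metis image_eqI subsetI)
qed

lemma arcs_sym: "(x, y) \<in> arcs G \<longleftrightarrow> (y, x) \<in> arcs G"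
  by (simp add: arcs_def insert_commute)

lemma arcs_helm_iff:
  assumes "m \<ge> 3"
  shows "(x, y) \<in> arcs (helm m) \<longleftrightarrow>
    x \<in> {1..m} \<and> (y = m + x \<or> y = 0 \<or> y = rim_next m x \<or> y = rim_prev m x) \<or>
    y \<in> {1..m} \<and> (x = m + y \<or> x = 0)"
proof -
  have pair_iff: "{x, y} \<in> (\<lambda>i. {i, h i}) ` S \<longleftrightarrow> x \<in> S \<and> y = h x \<or> y \<in> S \<and> x = h y"
    for h and S :: "nat set"
    unfolding image_iff doubleton_eq_iff by blast
  have "edges (helm m) = (\<lambda>i. {i, rim_next m i}) ` {1..m} \<union> (\<lambda>i. {i, 0}) ` {1..m} \<union>
    (\<lambda>i. {i, m + i}) ` {1..m}"
  proof -
    have "(\<lambda>i. {i, rim_next m i}) ` {1..m} =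
        (\<lambda>i. {i, rim_next m i}) ` {1..m - 1} \<union> (\<lambda>i. {i, rim_next m i}) ` {m}"
      using assms by (subst image_Un[symmetric]) (rule arg_cong[of _ _ "image _"], auto)
    also have "\<dots> = (\<lambda>i. {i, i + 1}) ` {1..m - 1} \<union> {{m, 1}}"
      unfolding rim_next_def using assms by (intro arg_cong2[of _ _ _ _ "(\<union>)"] image_cong) auto
    finally show ?thesis
      unfolding helm_def wheel_def snd_conv Setcompr_eq_image insert_commute[of 0] by blast
  qed
  then have "{x, y} \<in> edges (helm m) \<longleftrightarrow>
    x \<in> {1..m} \<and> (y = m + x \<or> y = 0 \<or> y = rim_next m x) \<or>
    y \<in> {1..m} \<and> (x = m + y \<or> x = 0 \<or> x = rim_next m y)"
    by (simp only: Un_iff pair_iff) blast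
  also have "\<dots> \<longleftrightarrow> x \<in> {1..m} \<and> (y = m + x \<or> y = 0 \<or> y = rim_next m x \<or> y = rim_prev m x) \<or>
    y \<in> {1..m} \<and> (x = m + y \<or> x = 0)"
  proof -
    have "y \<in> {1..m} \<and> x = rim_next m y \<longleftrightarrow> x \<in> {1..m} \<and> y = rim_prev m x"
      using rim_in[of x m] rim_in[of y m] rim_prev_next[of y m] rim_next_prev[of x m] by metis
    then show ?thesis by blast
  qed
  finally show ?thesis by (simp add: arcs_def)
qed

lemma helm_neighbours:
  assumes "m \<ge> 3"
  shows "{y. (0, y) \<in> arcs (helm m)} = {1..m}"
    and "i \<in> {1..m} \<Longrightarrow> {y. (i, y) \<in> arcs (helm m)} = {m + i, 0, rim_next m i, rim_prev m i}"
    and "i \<in> {1..m} \<Longrightarrow> {y. (m + i, y) \<in> arcs (helm m)} = {i}"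
proof -
  show "{y. (0, y) \<in> arcs (helm m)} = {1..m}"
    unfolding arcs_helm_iff[OF assms] by auto
  assume i: "i \<in> {1..m}"
  then have "\<not> (y \<in> {1..m} \<and> (i = m + y \<or> i = 0))" for y
    by simp
  then show "{y. (i, y) \<in> arcs (helm m)} = {m + i, 0, rim_next m i, rim_prev m i}"
    unfolding arcs_helm_iff[OF assms] using i by blast
  have "m + i \<notin> {1..m}" "y \<in> {1..m} \<and> (m + i = m + y \<or> m + i = 0) \<longleftrightarrow> y = i" for y
    using i by auto
  then show "{y. (m + i, y) \<in> arcs (helm m)} = {i}"
    unfolding arcs_helm_iff[OF assms] by blast
qed

lemma arcs_helm:
  assumes "m \<ge> 3"
  shows "arcs (helm m) =
    (\<lambda>i. (i, m + i)) ` {1..m} \<union> (\<lambda>i. (m + i, i)) ` {1..m} \<union> (\<lambda>i. (i, 0)) ` {1..m} \<union>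
    (\<lambda>i. (0, i)) ` {1..m} \<union> (\<lambda>i. (i, rim_next m i)) ` {1..m} \<union> (\<lambda>i. (i, rim_prev m i)) ` {1..m}"
  unfolding set_eq_iff split_paired_All Un_iff image_iff prod.inject arcs_helm_iff[OF assms] by blast

lemma verts_helm: "verts (helm m) = {0} \<union> {1..m} \<union> (+) m ` {1..m}"
proof -
  have "verts (helm m) = {0..2*m}" by (auto simp: helm_def wheel_def)
  moreover have "(+) m ` {1..m} = {m + 1..2 * m}" by (simp add: mult_2)
  moreover have "{0..2 * m} = {0} \<union> {1..m} \<union> {m + 1..2 * m}"
    by (rule set_eqI, simp only: Un_iff atLeastAtMost_iff singleton_iff) presburger
  ultimately show ?thesis by (simp only:)
qed

section \<open>Blocks of consecutive labels\<close>

text \<open>The column-by-column numbering of an \<open>m\<close> by \<open>n\<close> table from 1. The row-by-row numbering is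
  \<open>col n j i\<close>. Summed over a row, the former grows slowly (by \<open>n\<close>) with the row; summed over a column,
  the latter grows slowly (by \<open>m\<close>) with the column. Slow growth is what keeps windows short.\<close>

definition col :: "nat \<Rightarrow> nat \<Rightarrow> nat \<Rightarrow> nat" where
  "col m i j = m * (j - 1) + i"

lemma col_image: "(\<lambda>(i, j). col m i j) ` ({1..m} \<times> {1..n}) = {1..m * n}"
proof
  show "(\<lambda>(i, j). col m i j) ` ({1..m} \<times> {1..n}) \<subseteq> {1..m * n}"
  proof clarify
    fix i j assume ij: "i \<in> {1..m}" "j \<in> {1..n}"
    then obtain k where k: "j = Suc k" by (cases j) auto
    have "m * k + m \<le> m * n"
      using mult_le_mono2[of "Suc k" n m] ij k by simp
    then show "col m i j \<in> {1..m * n}"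
      using ij by (auto simp: col_def k)
  qed
  show "{1..m * n} \<subseteq> (\<lambda>(i, j). col m i j) ` ({1..m} \<times> {1..n})"
  proof
    fix t assume t: "t \<in> {1..m * n}"
    then have "m > 0" by (cases m) auto
    have "(t - 1) div m < n"
      using t by (intro less_mult_imp_div_less) (auto simp: mult.commute)
    moreover have "m * ((t - 1) div m) + ((t - 1) mod m + 1) = t"
      using t by simp
    ultimately show "t \<in> (\<lambda>(i, j). col m i j) ` ({1..m} \<times> {1..n})"
      using \<open>m > 0\<close>
      by (intro image_eqI[of _ _ "((t - 1) mod m + 1, (t - 1) div m + 1)"])
        (auto simp: col_def Suc_le_eq)
  qed
qed

lemma col_bounds: "i \<in> {1..m} \<Longrightarrow> j \<in> {1..n} \<Longrightarrow> 1 \<le> col m i j \<and> col m i j \<le> m * n"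
  using col_image[of m n] by (metis (no_types, lifting) SigmaI atLeastAtMost_iff image_eqI prod.case)

lemma inj_on_col: "inj_on (\<lambda>(i, j). col m i j) ({1..m} \<times> {1..n})"
  by (rule eq_card_imp_inj_on) (simp_all add: col_image del: One_nat_def)

lemma int_col: "j \<ge> 1 \<Longrightarrow> int (col m i j) = int m * (int j - 1) + int i"
  by (simp add: col_def of_nat_diff)

lemma sum_col_fixed_row:
  "2 * (\<Sum>j=1..n. int (col m i j)) = int n * (2 * int i + int m * (int n - 1))"
  by (induction n) (simp_all add: int_col algebra_simps)

lemma sum_col_fixed_col:
  "j \<ge> 1 \<Longrightarrow> 2 * (\<Sum>i=1..k. int (col m i j)) = int k * (2 * int m * (int j - 1) + int k + 1)"
  by (induction k) (simp_all add: int_col algebra_simps)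

lemma block_image:
  "(\<lambda>(i, j). k * (m * n) + col m i j) ` ({1..m} \<times> {1..n}) = {k * (m * n) + 1..k * (m * n) + m * n}"
proof -
  have "(\<lambda>(i, j). k * (m * n) + col m i j) ` ({1..m} \<times> {1..n}) =
      (+) (k * (m * n)) ` (\<lambda>(i, j). col m i j) ` ({1..m} \<times> {1..n})"
    by (simp only: image_image case_prod_unfold)
  then show ?thesis
    by (simp only: col_image image_add_atLeastAtMost add.commute)
qed

lemma block_image_transposed:
  "(\<lambda>(i, j). k * (m * n) + col n j i) ` ({1..m} \<times> {1..n}) = {k * (m * n) + 1..k * (m * n) + m * n}"
proof -
  have "(\<lambda>(i, j). k * (m * n) + col n j i) ` ({1..m} \<times> {1..n}) =
      (\<lambda>(j, i). k * (n * m) + col n j i) ` ({1..n} \<times> {1..m})"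
    unfolding product_swap[of "{1..m}" "{1..n}", symmetric] image_image
    by (simp only: case_prod_unfold prod.swap_def fst_conv snd_conv mult.commute)
  then show ?thesis
    using block_image[of k n m] by (simp only: mult.commute[of n m])
qed

text \<open>A block may be used in decreasing order and with its rows permuted: this lets the labels on two
  kinds of arcs add up to a constant.\<close>

lemma block_image_reversed:
  assumes "h ` {1..m} = {1..m}"
  shows "(\<lambda>(i, j). (k + 1) * (m * n) + 1 - col m (h i) j) ` ({1..m} \<times> {1..n}) =
    {k * (m * n) + 1..k * (m * n) + m * n}"
proof -
  have "(\<lambda>(i, j). (k + 1) * (m * n) + 1 - col m (h i) j) ` ({1..m} \<times> {1..n}) =
      (-) ((k + 1) * (m * n) + 1) ` (\<lambda>(i, j). col m i j) ` (map_prod h id ` ({1..m} \<times> {1..n}))"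
    by (simp only: image_image case_prod_unfold fst_map_prod snd_map_prod id_apply)
  also have "\<dots> = (-) ((k + 1) * (m * n) + 1) ` {1..m * n}"
    using map_prod_surj_on[OF assms, of id "{1..n}" "{1..n}"] col_image by simp
  also have "\<dots> = {k * (m * n) + 1..k * (m * n) + m * n}"
  proof -
    have "(-) (a + b + 1) ` {1..b} = {a + 1..a + b}" for a b :: nat
    proof
      show "(-) (a + b + 1) ` {1..b} \<subseteq> {a + 1..a + b}"
        by auto
      show "{a + 1..a + b} \<subseteq> (-) (a + b + 1) ` {1..b}"
      proof
        fix x assume "x \<in> {a + 1..a + b}"
        then show "x \<in> (-) (a + b + 1) ` {1..b}"
          by (intro image_eqI[of _ _ "a + b + 1 - x"]) auto
      qed
    qed
    from this[of "k * (m * n)" "m * n"] show ?thesis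
      by (simp add: algebra_simps)
  qed
  finally show ?thesis .
qed

section \<open>The labeling of the helm times a star\<close>

text \<open>The parameters \<open>b\<close>, \<open>c\<close>, \<open>e\<close>, \<open>f\<close> are the layers of the arcs pendant to rim, rim to hub, rim to next
  and rim to previous.\<close>

locale helm_layers =
  fixes m n b c e f :: nat
  assumes m: "m \<ge> 3" and n: "n \<ge> 2"
    and layers: "{b, c, e, f} = {1, 2, 3, 4}"
begin

text \<open>The arc from \<open>x\<close> to the previous rim vertex \<open>y\<close> takes the complement of the label on the arc that
  enters \<open>y\<close> from the other side, from \<open>rim_prev m y = rim_prev m (rim_prev m x)\<close>. Hence the two rim
  arcs entering \<open>y\<close> contribute a constant, and the sum at a rim copy is a constant plus the two
  labels from the pendant and the hub. Both of these increase with \<open>col m y j\<close>, so these \<open>m n\<close> sums are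
  distinct. The row-by-row numbering on the arcs to the hub keeps the hub copies within distance \<open>N/2\<close>
  of their mean.\<close>

definition label :: "nat \<Rightarrow> nat \<Rightarrow> nat \<Rightarrow> nat" where
  "label x y j =
    (if x = 0 then 5 * (m * n) + col m y j
     else if y = 0 then c * (m * n) + col n j x
     else if y = m + x then col m x j
     else if x = m + y then b * (m * n) + col m y j
     else if y = rim_next m x then e * (m * n) + col m x j
     else (f + 1) * (m * n) + 1 - col m (rim_prev m (rim_prev m x)) j)"

lemma label_simps:
  assumes "i \<in> {1..m}"
  shows "label 0 i j = 5 * (m * n) + col m i j"
    and "label i 0 j = c * (m * n) + col n j i"
    and "label i (m + i) j = col m i j"
    and "label (m + i) i j = b * (m * n) + col m i j"
    and "label i (rim_next m i) j = e * (m * n) + col m i j"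
    and "label i (rim_prev m i) j = (f + 1) * (m * n) + 1 - col m (rim_prev m (rim_prev m i)) j"
proof -
  have "rim_next m i \<in> {1..m}" "rim_prev m i \<in> {1..m}" "rim_prev m i \<noteq> rim_next m i"
    using rim_in rim_next_neq_prev m assms by metis+
  then show "label 0 i j = 5 * (m * n) + col m i j"
    and "label i 0 j = c * (m * n) + col n j i"
    and "label i (m + i) j = col m i j"
    and "label (m + i) i j = b * (m * n) + col m i j"
    and "label i (rim_next m i) j = e * (m * n) + col m i j"
    and "label i (rim_prev m i) j = (f + 1) * (m * n) + 1 - col m (rim_prev m (rim_prev m i)) j"
    using assms by (auto simp: label_def)
qed

lemma label_image: "(\<lambda>((x, y), j). label x y j) ` (arcs (helm m) \<times> {1..n}) = {1..6 * (m * n)}"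
proof -
  let ?N = "m * n"
  let ?B = "\<lambda>k. {k * ?N + 1..k * ?N + ?N}"
  let ?l = "\<lambda>((x, y), j). label x y j"
  have block: "?l ` ((\<lambda>i. (s i, t i)) ` {1..m} \<times> {1..n}) = (\<lambda>(i, j). h i j) ` ({1..m} \<times> {1..n})"
    if "\<And>i j. i \<in> {1..m} \<Longrightarrow> label (s i) (t i) j = h i j" for s t h
    using that by (force simp: image_iff)
  have pp: "(\<lambda>i. rim_prev m (rim_prev m i)) ` {1..m} = {1..m}"
    using rim_prev_image[of m] by (simp only: image_image[symmetric])
  have "?l ` (arcs (helm m) \<times> {1..n}) = ?B 0 \<union> ?B b \<union> ?B c \<union> ?B 5 \<union> ?B e \<union> ?B f"
    unfolding arcs_helm[OF m] Sigma_Un_distrib1 image_Un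
    using block[OF label_simps(1)] block[OF label_simps(2)] block[OF label_simps(3)]
      block[OF label_simps(4)] block[OF label_simps(5)] block[OF label_simps(6)]
      block_image[of 0 m n] block_image[of _ m n] block_image_transposed[of c m n]
      block_image_reversed[OF pp, of f n]
    by simp
  also have "\<dots> = (\<Union>k\<in>{0, 5} \<union> {b, c, e, f}. ?B k)"
    by blast
  also have "\<dots> = (\<Union>k\<in>{..<6}. ?B k)"
  proof -
    have "{0, 5} \<union> {b, c, e, f} = {..<6}"
      unfolding layers by auto
    then show ?thesis by (simp only:)
  qed
  also have "\<dots> = {1..6 * ?N}"
  proof
    show "(\<Union>k\<in>{..<6}. ?B k) \<subseteq> {1..6 * ?N}"
    proof (rule UN_least)
      fix k :: nat assume "k \<in> {..<6}"
      then have "Suc k * ?N \<le> 6 * ?N" by (intro mult_le_mono1) simp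
      then show "?B k \<subseteq> {1..6 * ?N}" by auto
    qed
    show "{1..6 * ?N} \<subseteq> (\<Union>k\<in>{..<6}. ?B k)"
    proof
      fix t assume t: "t \<in> {1..6 * ?N}"
      then have k: "(t - 1) div ?N < 6"
        by (intro less_mult_imp_div_less) auto
      have "0 < ?N" using m n by simp
      then have "t \<in> ?B ((t - 1) div ?N)"
        using t div_mult_mod_eq[of "t - 1" ?N] mod_less_divisor[OF \<open>0 < ?N\<close>, of "t - 1"]
        by (simp only: atLeastAtMost_iff) linarith
      with k show "t \<in> (\<Union>k\<in>{..<6}. ?B k)" by blast
    qed
  qed
  finally show ?thesis .
qed

text \<open>The six kinds of arcs have at most \<open>6 m\<close> members together, so a labeling that reaches all of the
  \<open>6 m n\<close> labels is injective.\<close>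

lemma card_arcs_helm_le: "card (arcs (helm m)) \<le> 6 * m"
proof -
  have *: "card (A \<union> h ` {1..m}) \<le> k + m" if "card A \<le> k"
    for A :: "(nat \<times> nat) set" and h :: "nat \<Rightarrow> nat \<times> nat" and k
    using card_Un_le[of A "h ` {1..m}"] card_image_le[of "{1..m}" h] that by simp
  have "card ((\<lambda>i. (i, m + i)) ` {1..m}) \<le> m"
    using card_image_le[of "{1..m}"] by simp
  note *[OF *[OF *[OF *[OF *[OF this]]]]]
  then show ?thesis
    unfolding arcs_helm[OF m] by (rule order_trans) simp
qed

lemma bij_label:
  "bij_betw (\<lambda>((x, y), j). label x y j) (arcs (helm m) \<times> {1..n}) {1..6 * (m * n)}"
  unfolding bij_betw_def
proof
  have fin: "finite (arcs (helm m) \<times> {1..n})"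
    unfolding arcs_helm[OF m] by simp
  have "card (arcs (helm m) \<times> {1..n}) \<le> card {1..6 * (m * n)}"
    using mult_le_mono1[OF card_arcs_helm_le, of n] by (simp add: card_cartesian_product)
  then show "inj_on (\<lambda>((x, y), j). label x y j) (arcs (helm m) \<times> {1..n})"
    using card_image_le[OF fin, of "\<lambda>((x, y), j). label x y j"] label_image
    by (intro eq_card_imp_inj_on fin) simp
qed (rule label_image)

subsection \<open>Closed forms of the vertex sums\<close>

abbreviation S :: "nat \<times> nat \<Rightarrow> nat" where
  "S \<equiv> star_sum (helm m) n label"

lemma in_neighbours: "{x. (x, v) \<in> arcs (helm m)} = {y. (v, y) \<in> arcs (helm m)}"
  by (subst arcs_sym) (rule refl)

lemma sum_rim_neighbours:
  fixes g :: "nat \<Rightarrow> nat"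
  assumes "i \<in> {1..m}"
  shows "(\<Sum>y\<in>{m + i, 0, rim_next m i, rim_prev m i}. g y) =
    g (m + i) + g 0 + g (rim_next m i) + g (rim_prev m i)"
proof -
  have "rim_next m i \<in> {1..m}" "rim_prev m i \<in> {1..m}" "rim_next m i \<noteq> rim_prev m i"
    using rim_in rim_next_neq_prev m assms by metis+
  then show ?thesis
    using assms by simp
qed

lemma S_hub: "S (0, 0) = (\<Sum>i=1..m. \<Sum>j=1..n. label 0 i j)"
  by (simp add: star_sum_def helm_neighbours(1)[OF m])

lemma S_pendant: "i \<in> {1..m} \<Longrightarrow> S (m + i, 0) = (\<Sum>j=1..n. label (m + i) i j)"
  by (simp add: star_sum_def helm_neighbours(3)[OF m])

lemma S_rim:
  assumes "i \<in> {1..m}"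
  shows "S (i, 0) = (\<Sum>j=1..n. label i (m + i) j) + (\<Sum>j=1..n. label i 0 j) +
    (\<Sum>j=1..n. label i (rim_next m i) j) + (\<Sum>j=1..n. label i (rim_prev m i) j)"
  using sum_rim_neighbours[OF assms, of "\<lambda>y. \<Sum>j=1..n. label i y j"]
  by (simp only: star_sum_def helm_neighbours(2)[OF m assms] prod.case simp_thms if_True)

lemma S_hub_copy: "j \<in> {1..n} \<Longrightarrow> S (0, j) = (\<Sum>i=1..m. label i 0 j)"
  by (simp add: star_sum_def in_neighbours helm_neighbours(1)[OF m])

lemma S_pendant_copy: "i \<in> {1..m} \<Longrightarrow> j \<in> {1..n} \<Longrightarrow> S (m + i, j) = label i (m + i) j"
  by (simp add: star_sum_def in_neighbours helm_neighbours(3)[OF m])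

lemma S_rim_copy:
  assumes "i \<in> {1..m}" "j \<in> {1..n}"
  shows "S (i, j) = label (m + i) i j + label 0 i j + label (rim_next m i) i j + label (rim_prev m i) i j"
proof -
  have "j \<noteq> 0" using assms by simp
  then show ?thesis
    using sum_rim_neighbours[OF assms(1), of "\<lambda>x. label x i j"]
    by (simp only: star_sum_def in_neighbours helm_neighbours(2)[OF m assms(1)] prod.case if_False)
qed

lemma layer_sum: "int c + int e + int f = 10 - int b"
proof -
  have "distinct [b, c, e, f]"
    using layers by (intro card_distinct) simp
  then have "sum id {b, c, e, f} = b + c + e + f"
    by simp
  then show ?thesis
    unfolding layers by simp
qed

lemma value_pendant_copy: "i \<in> {1..m} \<Longrightarrow> j \<in> {1..n} \<Longrightarrow> S (m + i, j) = col m i j"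
  by (simp add: S_pendant_copy label_simps)

lemma value_rim_copy:
  assumes "i \<in> {1..m}" "j \<in> {1..n}"
  shows "int (S (i, j)) = (16 - int c) * int (m * n) + 1 + 2 * int (col m i j)"
proof -
  let ?p = "rim_prev m i" and ?s = "rim_next m i"
  have ps: "?p \<in> {1..m}" "?s \<in> {1..m}" using rim_in assms by blast+
  have succ: "label ?p i j = e * (m * n) + col m ?p j"
    using label_simps(5)[OF ps(1), of j] by (simp only: rim_next_prev[OF assms(1)])
  have pred: "label ?s i j = (f + 1) * (m * n) + 1 - col m ?p j"
    using label_simps(6)[OF ps(2), of j] by (simp only: rim_prev_next[OF assms(1)])
  have "col m ?p j \<le> (f + 1) * (m * n) + 1"
    using col_bounds[OF ps(1) assms(2)] by simp
  then have "int (label ?s i j) = (int f + 1) * int (m * n) + 1 - int (col m ?p j)"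
    unfolding pred by (simp add: of_nat_diff algebra_simps)
  then have "int (S (i, j)) = (int b + 5 + int e + int f + 1) * int (m * n) + 1 + 2 * int (col m i j)"
    unfolding S_rim_copy[OF assms] succ label_simps[OF assms(1)] by (simp add: algebra_simps)
  moreover have "int b + 5 + int e + int f + 1 = 16 - int c"
    using layer_sum by simp
  ultimately show ?thesis by (simp only:)
qed

lemma value_hub_copy:
  assumes "j \<in> {1..n}"
  shows "2 * int (S (0, j)) = int (m * n) * ((2 * int c + 1) * int m - 1) + 2 * int m * int j"
proof -
  have "int (S (0, j)) = int m * int c * int (m * n) + (\<Sum>i=1..m. int (col n j i))"
    using label_simps(2) by (simp add: S_hub_copy[OF assms] sum.distrib)
  moreover have "2 * (\<Sum>i=1..m. int (col n j i)) = int m * (2 * int j + int n * (int m - 1))"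
    by (rule sum_col_fixed_row)
  ultimately show ?thesis by (simp add: algebra_simps)
qed

lemma value_pendant:
  assumes "i \<in> {1..m}"
  shows "2 * int (S (m + i, 0)) = int (m * n) * ((2 * int b + 1) * int n - 1) + 2 * int n * int i"
proof -
  have "int (S (m + i, 0)) = int n * int b * int (m * n) + (\<Sum>j=1..n. int (col m i j))"
    using label_simps(4)[OF assms] by (simp add: S_pendant[OF assms] sum.distrib)
  moreover note sum_col_fixed_row[of m i n]
  ultimately show ?thesis by (simp add: algebra_simps)
qed

text \<open>The arcs from rim vertex \<open>i\<close> to its two rim neighbours use table row \<open>i\<close> in increasing and row
  \<open>rim_prev m (rim_prev m i)\<close> in decreasing order; this is the difference of the two rows.\<close>

definition gap :: "nat \<Rightarrow> int" where
  "gap i = int i - int (rim_prev m (rim_prev m i))"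

lemma gap_eq: "i \<in> {1..m} \<Longrightarrow> gap i = (if i \<le> 2 then 2 - int m else 2)"
  using m by (auto simp: gap_def rim_prev_def)

lemma value_rim:
  assumes "i \<in> {1..m}"
  shows "2 * int (S (i, 0)) = int (m * n) * ((23 - 2 * int b) * int n - 1) +
    2 * int n + 2 * int n * int i + 2 * (int n)\<^sup>2 * (int i - 1) + int n * (int n + 1) + 2 * int n * gap i"
proof -
  let ?q = "rim_prev m (rim_prev m i)"
  have q: "?q \<in> {1..m}" using rim_in assms by blast
  have "int ((f + 1) * (m * n) + 1 - col m ?q j) = (int f + 1) * int (m * n) + 1 - int (col m ?q j)"
    if "j \<in> {1..n}" for j
  proof -
    have "col m ?q j \<le> (f + 1) * (m * n) + 1"
      using col_bounds[OF q that] by simp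
    then show ?thesis by (simp add: of_nat_diff algebra_simps)
  qed
  then have "int (\<Sum>j=1..n. label i (rim_prev m i) j) =
      int n * ((int f + 1) * int (m * n) + 1) - (\<Sum>j=1..n. int (col m ?q j))"
    using label_simps(6)[OF assms] by (simp add: sum_subtractf)
  then have S: "int (S (i, 0)) = int n * (int c + int e + int f + 1) * int (m * n) + int n +
      2 * (\<Sum>j=1..n. int (col m i j)) + (\<Sum>j=1..n. int (col n j i)) - (\<Sum>j=1..n. int (col m ?q j))"
    unfolding S_rim[OF assms] using label_simps[OF assms] by (simp add: sum.distrib algebra_simps)
  have coeff: "int c + int e + int f + 1 = 11 - int b"
    using layer_sum by simp
  have "2 * (\<Sum>j=1..n. int (col n j i)) = int n * (2 * int n * (int i - 1) + int n + 1)"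
    using assms by (intro sum_col_fixed_col) simp
  moreover note S[unfolded coeff] sum_col_fixed_row[of m i n] sum_col_fixed_row[of m ?q n]
  ultimately show ?thesis
    unfolding gap_def by (simp add: algebra_simps power2_eq_square)
qed

subsection \<open>Windows for the vertex sums\<close>

text \<open>Doubling the sums and dividing by \<open>m n\<close> turns every comparison between classes into a linear
  one in \<open>m\<close> and \<open>n\<close>, once \<open>b\<close> and \<open>c\<close> are known.\<close>

lemma int_mn: "int m \<ge> 3" "int n \<ge> 2" "int (m * n) \<ge> 6"
proof -
  show "int m \<ge> 3" "int n \<ge> 2" using m n by simp_all
  have "3 * 2 \<le> m * n" using m n by (intro mult_le_mono)
  then show "int (m * n) \<ge> 6" by linarith
qed

lemma window_pendant:
  assumes "i \<in> {1..m}"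
  shows "int (m * n) * ((2 * int b + 1) * int n - 1) < 2 * int (S (m + i, 0))"
    and "2 * int (S (m + i, 0)) \<le> int (m * n) * ((2 * int b + 1) * int n + 1)"
proof -
  have "0 < int n * int i" "int n * int i \<le> int n * int m"
    using assms n by (simp_all add: mult_left_mono)
  then show "int (m * n) * ((2 * int b + 1) * int n - 1) < 2 * int (S (m + i, 0))"
    and "2 * int (S (m + i, 0)) \<le> int (m * n) * ((2 * int b + 1) * int n + 1)"
    unfolding value_pendant[OF assms] by (simp_all add: algebra_simps)
qed

lemma window_hub_copy:
  assumes "j \<in> {1..n}"
  shows "int (m * n) * ((2 * int c + 1) * int m - 1) < 2 * int (S (0, j))"
    and "2 * int (S (0, j)) \<le> int (m * n) * ((2 * int c + 1) * int m + 1)"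
proof -
  have "0 < int m * int j" "int m * int j \<le> int m * int n"
    using assms m by (simp_all add: mult_left_mono)
  then show "int (m * n) * ((2 * int c + 1) * int m - 1) < 2 * int (S (0, j))"
    and "2 * int (S (0, j)) \<le> int (m * n) * ((2 * int c + 1) * int m + 1)"
    unfolding value_hub_copy[OF assms] by (simp_all add: algebra_simps)
qed

lemma window_rim_copy:
  assumes "i \<in> {1..m}" "j \<in> {1..n}"
  shows "int (m * n) * (32 - 2 * int c) < 2 * int (S (i, j))"
    and "2 * int (S (i, j)) \<le> int (m * n) * (37 - 2 * int c)"
proof -
  have "1 \<le> int (col m i j)" "int (col m i j) \<le> int (m * n)"
    using col_bounds[OF assms] by linarith+
  then show "int (m * n) * (32 - 2 * int c) < 2 * int (S (i, j))"
    and "2 * int (S (i, j)) \<le> int (m * n) * (37 - 2 * int c)"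
    using int_mn(3) unfolding value_rim_copy[OF assms] by (simp_all add: algebra_simps)
qed

lemma window_rim:
  assumes "i \<in> {1..m}"
  shows "int (m * n) * ((23 - 2 * int b) * int n - 3) < 2 * int (S (i, 0))"
    and "2 * int (S (i, 0)) \<le> int (m * n) * ((25 - 2 * int b) * int n + 3)"
proof -
  let ?m = "int m" and ?n = "int n" and ?i = "int i"
  have gap: "2 - ?m \<le> gap i" "gap i \<le> 2"
    using gap_eq[OF assms] m by auto
  have i: "1 \<le> ?i" "?i \<le> ?m" using assms by simp_all
  have "?n * ?i \<ge> ?n * 1" "?n\<^sup>2 * (?i - 1) \<ge> ?n\<^sup>2 * 0" "?n * gap i \<ge> ?n * (2 - ?m)"
    "?n * ?i \<le> ?n * ?m" "?n\<^sup>2 * (?i - 1) \<le> ?n\<^sup>2 * (?m - 1)" "?n * gap i \<le> ?n * 2"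
    using gap i by (intro mult_left_mono; simp)+
  \<comment> \<open>The part of the doubled sum that is not a multiple of \<open>m n\<close> is at most \<open>7 n - n\<^sup>2 \<le> 12 \<le> 2 m n\<close>.\<close>
  moreover have "(?n - 3) * (?n - 4) \<ge> 0"
  proof (cases "?n \<le> 3")
    case True
    then show ?thesis by (intro mult_nonpos_nonpos) auto
  next
    case False
    then show ?thesis by (intro mult_nonneg_nonneg) auto
  qed
  moreover have "?n > 0" "?n * ?n > 0" "?m * ?n \<ge> 6" using int_mn by simp_all
  ultimately show "int (m * n) * ((23 - 2 * int b) * int n - 3) < 2 * int (S (i, 0))"
    and "2 * int (S (i, 0)) \<le> int (m * n) * ((25 - 2 * int b) * int n + 3)"
    unfolding value_rim[OF assms]
    by (simp_all only: of_nat_mult algebra_simps power2_eq_square)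
qed

lemma window_hub: "2 * int (S (0, 0)) > int (m * n) * (10 * int (m * n))"
proof -
  have "(\<Sum>i=1..m. \<Sum>j=1..n. 5 * (m * n) + 1) \<le> S (0, 0)"
    unfolding S_hub using label_simps(1) col_bounds by (intro sum_mono) fastforce
  then have "m * n * (5 * (m * n) + 1) \<le> S (0, 0)"
    by (simp add: algebra_simps)
  then have "int (m * n * (5 * (m * n) + 1)) \<le> int (S (0, 0))"
    by (simp only: of_nat_le_iff)
  then show ?thesis
    using int_mn(3) by (simp add: algebra_simps)
qed

lemma window_less:
  assumes "2 * int x \<le> int (m * n) * u" "int (m * n) * v < 2 * int y" "u \<le> v"
  shows "x < y"
proof -
  have "int (m * n) * u \<le> int (m * n) * v"
    using assms(3) by (intro mult_left_mono) simp_all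
  with assms(1,2) show ?thesis by linarith
qed

subsection \<open>Injectivity within a class\<close>

text \<open>No term of \<open>value_rim\<close> decreases with \<open>i\<close>, not even the gap: it jumps up by \<open>m\<close>
  after \<open>i = 2\<close>. The arcs leaving \<open>i\<close> use row \<open>i\<close> and the row two steps back, so the rim wraps around
  at the two smallest indices, where it cannot cause a drop.\<close>

lemma rim_strict_mono:
  assumes "i \<in> {1..m}" "k \<in> {1..m}" "i < k"
  shows "S (i, 0) < S (k, 0)"
proof -
  have "gap i \<le> gap k"
    using assms m by (simp add: gap_eq)
  then have "int n * gap i \<le> int n * gap k" "(int n)\<^sup>2 * int i \<le> (int n)\<^sup>2 * int k"
    using assms(3) by (auto intro!: mult_left_mono)
  moreover have "int n * int i < int n * int k"
    using assms(3) n by simp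
  ultimately have "2 * int (S (i, 0)) < 2 * int (S (k, 0))"
    unfolding value_rim[OF assms(1)] value_rim[OF assms(2)] by (simp add: algebra_simps)
  then show ?thesis by simp
qed

lemma inj_rim: "inj_on S ((\<lambda>i. (i, 0)) ` {1..m})"
proof (rule inj_on_imageI, rule inj_onI, unfold comp_def)
  fix i k assume "i \<in> {1..m}" "k \<in> {1..m}" "S (i, 0) = S (k, 0)"
  then show "i = k"
    using rim_strict_mono[of i k] rim_strict_mono[of k i] by linarith
qed

lemma inj_pendant: "inj_on S ((\<lambda>i. (m + i, 0)) ` {1..m})"
proof (rule inj_on_imageI, rule inj_onI, unfold comp_def)
  fix i k assume "i \<in> {1..m}" "k \<in> {1..m}" "S (m + i, 0) = S (m + k, 0)"
  then have "2 * int n * int i = 2 * int n * int k"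
    using value_pendant[of i] value_pendant[of k] by (metis add_left_cancel)
  then show "i = k" using n by simp
qed

lemma inj_hub_copy: "inj_on S (Pair 0 ` {1..n})"
proof (rule inj_on_imageI, rule inj_onI, unfold comp_def)
  fix j k assume "j \<in> {1..n}" "k \<in> {1..n}" "S (0, j) = S (0, k)"
  then have "2 * int m * int j = 2 * int m * int k"
    using value_hub_copy[of j] value_hub_copy[of k] by (metis add_left_cancel)
  then show "j = k" using m by simp
qed

lemma inj_rim_copy: "inj_on S ({1..m} \<times> {1..n})"
proof (rule inj_onI)
  fix s t assume st: "s \<in> {1..m} \<times> {1..n}" "t \<in> {1..m} \<times> {1..n}" "S s = S t"
  obtain i j i' j' where [simp]: "s = (i, j)" "t = (i', j')"
    by (cases s, cases t)
  have "col m i j = col m i' j'"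
    using value_rim_copy[of i j] value_rim_copy[of i' j'] st by simp
  then show "s = t"
    using inj_onD[OF inj_on_col _ st(1,2)] by simp
qed

lemma inj_pendant_copy: "inj_on S ((\<lambda>(i, j). (m + i, j)) ` ({1..m} \<times> {1..n}))"
proof (rule inj_on_imageI, rule inj_onI)
  fix s t assume st: "s \<in> {1..m} \<times> {1..n}" "t \<in> {1..m} \<times> {1..n}"
    "(S \<circ> (\<lambda>(i, j). (m + i, j))) s = (S \<circ> (\<lambda>(i, j). (m + i, j))) t"
  obtain i j i' j' where [simp]: "s = (i, j)" "t = (i', j')"
    by (cases s, cases t)
  have "col m i j = col m i' j'"
    using value_pendant_copy[of i j] value_pendant_copy[of i' j'] st by simp
  then show "s = t"
    using inj_onD[OF inj_on_col _ st(1,2)] by simp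
qed

subsection \<open>Comparisons that hold for every choice of layers\<close>

lemma layer_cases: "b = 1 \<or> b = 2 \<or> b = 3 \<or> b = 4" "c = 1 \<or> c = 2 \<or> c = 3 \<or> c = 4"
  using layers by blast+

lemma pendant_less_rim:
  assumes "i \<in> {1..m}" "k \<in> {1..m}"
  shows "S (m + i, 0) < S (k, 0)"
  using int_mn(2) layer_cases(1)
  by (intro window_less[OF window_pendant(2)[OF assms(1)] window_rim(1)[OF assms(2)]]) auto

lemma less_hub:
  shows "i \<in> {1..m} \<Longrightarrow> S (i, 0) < S (0, 0)"
    and "i \<in> {1..m} \<Longrightarrow> S (m + i, 0) < S (0, 0)"
    and "j \<in> {1..n} \<Longrightarrow> S (0, j) < S (0, 0)"
    and "i \<in> {1..m} \<Longrightarrow> j \<in> {1..n} \<Longrightarrow> S (i, j) < S (0, 0)"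
proof -
  have mn: "3 * int n \<le> int (m * n)" "int m * 2 \<le> int (m * n)"
    using m n by (simp_all add: mult_right_mono mult_left_mono)
  show rim: "S (i, 0) < S (0, 0)" if "i \<in> {1..m}" for i
    using mn int_mn(1,2) layer_cases(1)
    by (intro window_less[OF window_rim(2)[OF that] window_hub]) (auto simp del: of_nat_mult)
  show "S (m + i, 0) < S (0, 0)" if "i \<in> {1..m}" for i
    using pendant_less_rim[OF that that] rim[OF that] by simp
  show "S (0, j) < S (0, 0)" if "j \<in> {1..n}" for j
    using mn int_mn(1,2) layer_cases(2)
    by (intro window_less[OF window_hub_copy(2)[OF that] window_hub]) (auto simp del: of_nat_mult)
  show "S (i, j) < S (0, 0)" if "i \<in> {1..m}" "j \<in> {1..n}" for i j
    using int_mn layer_cases(2)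
    by (intro window_less[OF window_rim_copy(2)[OF that] window_hub]) auto
qed

lemma pendant_copy_less:
  assumes "i \<in> {1..m}" "j \<in> {1..n}"
  shows "k \<in> {1..m} \<Longrightarrow> S (m + i, j) < S (k, 0)"
    and "k \<in> {1..m} \<Longrightarrow> S (m + i, j) < S (m + k, 0)"
    and "l \<in> {1..n} \<Longrightarrow> S (m + i, j) < S (0, l)"
    and "k \<in> {1..m} \<Longrightarrow> l \<in> {1..n} \<Longrightarrow> S (m + i, j) < S (k, l)"
    and "S (m + i, j) < S (0, 0)"
proof -
  have *: "2 * int (S (m + i, j)) \<le> int (m * n) * 2"
    using col_bounds[OF assms] by (simp add: value_pendant_copy[OF assms] flip: of_nat_mult)
  show "S (m + i, j) < S (k, 0)" if "k \<in> {1..m}"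
    using int_mn layer_cases(1) by (intro window_less[OF * window_rim(1)[OF that]]) auto
  show P: "S (m + i, j) < S (m + k, 0)" if "k \<in> {1..m}" for k
    using int_mn layer_cases(1) by (intro window_less[OF * window_pendant(1)[OF that]]) auto
  show "S (m + i, j) < S (0, l)" if "l \<in> {1..n}"
    using int_mn layer_cases(2) by (intro window_less[OF * window_hub_copy(1)[OF that]]) auto
  show "S (m + i, j) < S (k, l)" if "k \<in> {1..m}" "l \<in> {1..n}"
    using layer_cases(2) by (intro window_less[OF * window_rim_copy(1)[OF that]]) auto
  show "S (m + i, j) < S (0, 0)"
    using P[OF assms(1)] less_hub(2)[OF assms(1)] by simp
qed

end

section \<open>The choice of layers\<close>

text \<open>The clauses compare, in units of \<open>m n / 2\<close>, the windows of the pendants with the rim copies, of the hub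
  copies with the rim copies, the pendants and the rim, and of the rim copies with the rim.\<close>

definition separated :: "int \<Rightarrow> int \<Rightarrow> int \<Rightarrow> int \<Rightarrow> bool" where
  "separated m n b c \<longleftrightarrow>
    ((2 * b + 1) * n + 1 \<le> 32 - 2 * c \<or> 37 - 2 * c \<le> (2 * b + 1) * n - 1) \<and>
    ((2 * c + 1) * m + 1 \<le> 32 - 2 * c \<or> 37 - 2 * c \<le> (2 * c + 1) * m - 1) \<and>
    ((2 * c + 1) * m + 1 \<le> (2 * b + 1) * n - 1 \<or> (2 * b + 1) * n + 1 \<le> (2 * c + 1) * m - 1) \<and>
    ((2 * c + 1) * m + 1 \<le> (23 - 2 * b) * n - 3 \<or> (25 - 2 * b) * n + 3 \<le> (2 * c + 1) * m - 1) \<and>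
    37 - 2 * c \<le> (23 - 2 * b) * n - 3"

text \<open>Start with \<open>b = 1\<close>. The rim window is then about seven times as high as the pendant window, while the
  hub copies for \<open>c = 4\<close> are only \<open>9/5\<close> times as high as for \<open>c = 2\<close>, which is nevertheless more than the
  ratio of the ends of the rim window. So when \<open>c = 2\<close> fails because of the rim or the pendants,
  \<open>c = 4\<close> does not fail because of either. This leaves the collisions with the rim copies, which are
  confined to small numbers: the hub copies meet them for \<open>c = 2\<close>, \<open>m = 6\<close> and \<open>c = 4\<close>, \<open>m = 3\<close>, the
  pendants for \<open>8 \<le> n \<le> 11\<close>. Where neither value of \<open>c\<close> works, \<open>(2, 3)\<close> does.\<close>

lemma separated_layers:
  assumes "m \<ge> 3" "n \<ge> 2"
  shows "separated m n 1 2 \<or> separated m n 1 4 \<or> separated m n 2 3"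
  using assms unfolding separated_def by simp (smt (z3))

lemma inj_on_Un_distinct:
  "inj_on g A \<Longrightarrow> inj_on g B \<Longrightarrow> (\<And>x y. x \<in> A \<Longrightarrow> y \<in> B \<Longrightarrow> g x \<noteq> g y) \<Longrightarrow> inj_on g (A \<union> B)"
  unfolding inj_on_def Ball_def Un_iff by metis

section \<open>Distinctness of all vertex sums\<close>

locale separated_helm_layers = helm_layers +
  assumes separated: "separated (int m) (int n) (int b) (int c)"
begin

lemma separations:
  assumes "i \<in> {1..m}" "k \<in> {1..m}" "j \<in> {1..n}" "l \<in> {1..n}"
  shows "S (m + i, 0) \<noteq> S (k, l)"
    and "S (0, j) \<noteq> S (k, l)"
    and "S (0, j) \<noteq> S (m + k, 0)"
    and "S (0, j) \<noteq> S (k, 0)"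
    and "S (k, l) < S (i, 0)"
proof -
  note P = window_pendant and U = window_rim and H = window_hub_copy and R = window_rim_copy
  show "S (m + i, 0) \<noteq> S (k, l)"
    using window_less[OF P(2) R(1), of i k l] window_less[OF R(2) P(1), of k l i] separated assms
    unfolding separated_def by (metis less_irrefl)
  show "S (0, j) \<noteq> S (k, l)"
    using window_less[OF H(2) R(1), of j k l] window_less[OF R(2) H(1), of k l j] separated assms
    unfolding separated_def by (metis less_irrefl)
  show "S (0, j) \<noteq> S (m + k, 0)"
    using window_less[OF H(2) P(1), of j k] window_less[OF P(2) H(1), of k j] separated assms
    unfolding separated_def by (metis less_irrefl)
  show "S (0, j) \<noteq> S (k, 0)"
    using window_less[OF H(2) U(1), of j k] window_less[OF U(2) H(1), of k j] separated assms
    unfolding separated_def by (metis less_irrefl)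
  show "S (k, l) < S (i, 0)"
    using window_less[OF R(2) U(1), of k l i] separated assms
    unfolding separated_def by metis
qed

lemma verts_split:
  "verts (helm m) \<times> {0..n} =
    (\<lambda>(i, j). (m + i, j)) ` ({1..m} \<times> {1..n}) \<union> ({1..m} \<times> {1..n} \<union> (Pair 0 ` {1..n} \<union>
    ((\<lambda>i. (m + i, 0)) ` {1..m} \<union> ((\<lambda>i. (i, 0)) ` {1..m} \<union> {(0, 0)}))))"
proof -
  have split: "(Z \<union> R \<union> Q) \<times> (Y \<union> J) = Q \<times> J \<union> (R \<times> J \<union> (Z \<times> J \<union> (Q \<times> Y \<union> (R \<times> Y \<union> Z \<times> Y))))"
    for Z R Q Y J :: "nat set"
    by blast
  have "{0..n} = {0} \<union> {1..n}" by auto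
  moreover have "(\<lambda>(i, j). (m + i, j)) ` ({1..m} \<times> {1..n}) = (+) m ` {1..m} \<times> {1..n}"
    using image_paired_Times[of "(+) m" "\<lambda>j. j" "{1..m}" "{1..n}"] by (simp only: image_ident)
  moreover have "Pair (0 :: nat) ` {1..n} = {0} \<times> {1..n}"
    "(\<lambda>i. (m + i, 0 :: nat)) ` {1..m} = (+) m ` {1..m} \<times> {0}"
    "(\<lambda>i. (i, 0 :: nat)) ` {1..m} = {1..m} \<times> {0}" "{(0 :: nat, 0 :: nat)} = {0} \<times> {0}"
    by blast+
  ultimately show ?thesis
    by (simp only: verts_helm split)
qed

lemma inj_S: "inj_on S (verts (helm m) \<times> {0..n})"
proof -
  have 1: "S s \<noteq> S t" if "s \<in> (\<lambda>i. (i, 0)) ` {1..m}" "t \<in> {(0, 0)}" for s t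
    using that less_hub(1) by (elim imageE singletonE; hypsubst) (metis less_irrefl)
  have 2: "S s \<noteq> S t" if "s \<in> (\<lambda>i. (m + i, 0)) ` {1..m}"
    "t \<in> (\<lambda>i. (i, 0)) ` {1..m} \<union> {(0, 0)}" for s t
    using that less_hub(2) pendant_less_rim
    by (elim imageE singletonE UnE; hypsubst) (metis less_irrefl)+
  have 3: "S s \<noteq> S t" if "s \<in> Pair 0 ` {1..n}"
    "t \<in> (\<lambda>i. (m + i, 0)) ` {1..m} \<union> ((\<lambda>i. (i, 0)) ` {1..m} \<union> {(0, 0)})" for s t
    using that less_hub(3) separations(3,4)
    by (elim imageE singletonE UnE; hypsubst) (metis less_irrefl)+
  have 4: "S s \<noteq> S t" if "s \<in> {1..m} \<times> {1..n}"
    "t \<in> Pair 0 ` {1..n} \<union> ((\<lambda>i. (m + i, 0)) ` {1..m} \<union> ((\<lambda>i. (i, 0)) ` {1..m} \<union> {(0, 0)}))" for s t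
    using that less_hub(4) separations(1,2,5)
    by (elim imageE singletonE UnE SigmaE; hypsubst) (metis less_irrefl)+
  have 5: "S s \<noteq> S t" if "s \<in> (\<lambda>(i, j). (m + i, j)) ` ({1..m} \<times> {1..n})"
    "t \<in> {1..m} \<times> {1..n} \<union> (Pair 0 ` {1..n} \<union>
      ((\<lambda>i. (m + i, 0)) ` {1..m} \<union> ((\<lambda>i. (i, 0)) ` {1..m} \<union> {(0, 0)})))" for s t
    using that
    by (elim imageE singletonE UnE SigmaE; hypsubst; unfold prod.case) (metis pendant_copy_less less_irrefl)+
  have "inj_on S {(0, 0)}"
    by simp
  from inj_on_Un_distinct[OF inj_rim this 1]
  have "inj_on S ((\<lambda>i. (i, 0)) ` {1..m} \<union> {(0, 0)})" .
  from inj_on_Un_distinct[OF inj_pendant_copy inj_on_Un_distinct[OF inj_rim_copy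
      inj_on_Un_distinct[OF inj_hub_copy inj_on_Un_distinct[OF inj_pendant this 2] 3] 4] 5]
  show ?thesis
    unfolding verts_split .
qed

end

theorem theorem8:
  fixes m n :: nat
  assumes "m \<ge> 3" and "n \<ge> 2"
  shows "antimagic (tensor_product (helm m) (star n))"
proof -
  have "antimagic (tensor_product (helm m) (star n))"
    if "{b, c, e, f} = {1, 2, 3, 4}" "separated (int m) (int n) (int b) (int c)" for b c e f
  proof -
    interpret separated_helm_layers m n b c e f
      using assms that by unfold_locales
    show ?thesis
      by (rule antimagic_tensor_starI[OF bij_label inj_S])
  qed
  \<comment> \<open>The layers of the two kinds of arcs along the rim are whatever \<open>b\<close> and \<open>c\<close> leave over.\<close>
  note this[of 1 2 3 4] this[of 1 4 2 3] this[of 2 3 1 4]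
  moreover have "{1, 4, 2, 3} = {1, 2, 3, 4 :: nat}" "{2, 3, 1, 4} = {1, 2, 3, 4 :: nat}"
    by auto
  ultimately show ?thesis
    using separated_layers[of "int m" "int n"] assms by auto
qed

end
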